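(* Let $m,n\in\mathbb{N}$ and $a,b\in\mathbb{Z}$ with $a\neq0$ and $b\neq0$. Then for all $x,y,z\in\mathbb{R}$, \begin{align*} &m\,a\,\overline{B}_{m-1}(ax+y)\overline{B}_{n}(bx+z)+n\,b\,\overline{B}_{m}(ax+y)\overline{B}_{n-1}(bx+z)\\ &=n\,b^{n-1}\mathrm{sgn}(b)\sum_{j=0}^{m}\binom{m}{j}(-1)^{j}a^{m-j}\sum_{l=1}^{|b|}\overline{B}_{j}\Bigl(\frac{a(l+z)}{b}-y\Bigr)\overline{B}_{m+n-j-1}\Bigl(x+\frac{l+z}{b}\Bigr)\\ &\quad+m\,a^{m-1}\mathrm{sgn}(a)\sum_{j=0}^{n}\binom{n}{j}(-1)^{j}b^{n-j}\sum_{l=1}^{|a|}\overline{B}_{j}\Bigl(\frac{b(l+y)}{a}-z\Bigr)\overline{B}_{m+n-j-1}\Bigl(x+\frac{l+y}{a}\Bigr)\\ &\quad-\mathrm{sgn}(ab)\,\delta_{\mathbb{Z}}(ax+y)\,\delta_{\mathbb{Z}}(bx+z)\,\frac{\delta_{1,m-1}\delta_{1,n}\,m a+\delta_{1,m}\delta_{1,n-1}\,n b}{4}. \end{align*}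
   Context: $\{x\}$ denotes the fractional part of $x$; $B_n(x)$ is the $n$-th Bernoulli polynomial. Bernoulli functions: $\overline{B}_{0}(x)=1$; $\overline{B}_{1}(x)=\{x\}-\frac12$ for $x\notin\mathbb{Z}$ and $0$ for $x\in\mathbb{Z}$; $\overline{B}_{n}(x)=B_{n}(\{x\})$ for $n\ge2$. $\delta_{\mathbb{Z}}(x)=1$ if $x\in\mathbb{Z}$, $0$ otherwise; $\delta_{l,k}$ is the Kronecker delta; $\mathrm{sgn}$ is the sign function ($\mathrm{sgn}(0)=0$). *)

theory Defs
  imports Complex_Main "HOL-Computational_Algebra.Formal_Power_Series"
begin

text \<open>
  Bernoulli polynomials, via \<open>t exp(x t) / (exp t - 1) = (\<Sum>n. B\<^sub>n(x) t\<^sup>n / n!)\<close>.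
\<close>

definition bernpoly :: "nat \<Rightarrow> real \<Rightarrow> real" where
  "bernpoly n x = fact n * fps_nth (fps_X * fps_exp x / (fps_exp 1 - 1)) n"

definition bernfun :: "nat \<Rightarrow> real \<Rightarrow> real" where
  "bernfun n x =
     (if n = 0 then 1
      else if n = 1 then (if x \<in> \<int> then 0 else frac x - 1 / 2)
      else bernpoly n (frac x))"

definition delta_Ints :: "real \<Rightarrow> real" where
  "delta_Ints x = (if x \<in> \<int> then 1 else 0)"

definition kronecker :: "nat \<Rightarrow> nat \<Rightarrow> real" where
  "kronecker l k = (if l = k then 1 else 0)"

text \<open>
  The division above is exact, even though the denominator is not a unit of the
  ring of formal power series.
\<close>

lemma bernpoly_generating_function:
  "Abs_fps (\<lambda>n. bernpoly n x / fact n) * (fps_exp 1 - 1) = fps_X * fps_exp x"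
proof -
  have nz: "fps_nth (fps_exp 1 - 1 :: real fps) 1 \<noteq> 0"
    by simp
  then have "fps_exp 1 - 1 \<noteq> (0 :: real fps)"
    by (metis fps_zero_nth)
  moreover have "subdegree (fps_exp 1 - 1 :: real fps) = 1"
    by (rule subdegreeI) auto
  ultimately have "fps_exp 1 - 1 dvd (fps_X * fps_exp x :: real fps)"
    by (subst fps_dvd_iff) (auto simp: subdegree_mult)
  moreover have "Abs_fps (\<lambda>n. bernpoly n x / fact n) = fps_X * fps_exp x / (fps_exp 1 - 1)"
    by (rule fps_ext) (simp add: bernpoly_def)
  ultimately show ?thesis
    by (metis dvd_div_mult_self)
qed

end

theory Submission
  imports Defs "HOL-Computational_Algebra.Polynomial"
begin

text \<open>
  Let \<open>G\<^sub>c(x)\<close> be the exponential generating function of the Bernoulli functions at \<open>x\<close> in the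
  variable \<open>c t\<close>. For small \<open>h \<noteq> 0\<close> one has \<open>G\<^sub>c(x + h) = exp(c h t) (G\<^sub>c(x) - sgn(h) J\<^sub>c(x))\<close>,
  where \<open>J\<^sub>c(x)\<close> is \<open>c t / 2\<close> if \<open>x\<close> is an integer and zero otherwise. Two functions of period 1
  with the same growth rate \<open>w \<noteq> 0\<close> and the same jumps agree: their difference times \<open>exp(- w x t)\<close>
  is locally constant, hence constant, and the period then forces the difference to vanish.
  With \<open>w = a u + b v\<close>, this applies to
  \<open>w (G\<^sub>u(a x + y) G\<^sub>v(b x + z) + sgn(a b) J\<^sub>u(a x + y) J\<^sub>v(b x + z))\<close> and a combination of sums of
  products \<open>G\<^bsub>- u\<^esub> G\<^sub>w\<close> and \<open>G\<^bsub>- v\<^esub> G\<^sub>w\<close>; the product of the two jumps is the source of the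
  \<open>\<delta>\<close> term in the theorem. At \<open>t\<^bsup>m+n-1\<^esup>\<close> both sides are binary forms of degree \<open>m + n\<close> in \<open>u\<close> and
  \<open>v\<close>, and comparing their coefficients at \<open>u\<^sup>m v\<^sup>n\<close> gives the theorem.
\<close>

subsection \<open>Generating functions of the Bernoulli polynomials and functions\<close>

definition bernpoly_fps :: "real \<Rightarrow> real \<Rightarrow> real fps" where
  "bernpoly_fps c x = Abs_fps (\<lambda>n. bernpoly n x / fact n * c ^ n)"

lemma bernpoly_fps_mult_exp_minus_1:
  "bernpoly_fps c x * (fps_exp c - 1) = fps_const c * fps_X * fps_exp (c * x)"
proof -
  have nth_0: "fps_nth (fps_const c * fps_X) 0 = 0"
    by simp
  have "bernpoly_fps c x = Abs_fps (\<lambda>n. bernpoly n x / fact n) oo (fps_const c * fps_X)"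
    by (simp add: bernpoly_fps_def fps_compose_linear mult.commute[of "c ^ _"])
  moreover have "(fps_exp 1 - 1) oo (fps_const c * fps_X) = fps_exp c - (1 :: real fps)"
    by (simp add: fps_compose_sub_distrib)
  ultimately have "bernpoly_fps c x * (fps_exp c - 1)
      = (fps_X * fps_exp x) oo (fps_const c * fps_X)"
    by (metis nth_0 bernpoly_generating_function fps_compose_mult_distrib)
  also have "\<dots> = fps_const c * fps_X * fps_exp (c * x)"
    by (simp add: fps_compose_mult_distrib)
  finally show ?thesis .
qed

lemma fps_exp_eq_1_iff [simp]: "fps_exp c = (1 :: 'a :: field_char_0 fps) \<longleftrightarrow> c = 0"
  by (metis fps_exp_0 fps_exp_eq_iff)

lemma bernpoly_0: "bernpoly 0 x = 1"
proof -
  have "fps_nth (bernpoly_fps 1 x * (fps_exp 1 - 1)) 1 = 1"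
    unfolding bernpoly_fps_mult_exp_minus_1 by simp
  then show ?thesis
    by (simp add: fps_mult_nth_1 bernpoly_fps_def)
qed

lemma bernpoly_fps_0: "bernpoly_fps 0 x = 1"
  by (rule fps_ext) (simp add: bernpoly_fps_def power_0_left bernpoly_0)

lemma bernpoly_fps_eqI:
  assumes "c \<noteq> 0" and "f * (fps_exp c - 1) = fps_const c * fps_X * fps_exp (c * x)"
  shows "bernpoly_fps c x = f"
  using assms by (simp flip: bernpoly_fps_mult_exp_minus_1)

lemma bernpoly_fps_add: "bernpoly_fps c (x + h) = fps_exp (c * h) * bernpoly_fps c x"
proof (cases "c = 0")
  case False
  have "fps_exp (c * h) * bernpoly_fps c x * (fps_exp c - 1)
      = fps_const c * fps_X * (fps_exp (c * x) * fps_exp (c * h))"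
    by (simp only: mult.assoc bernpoly_fps_mult_exp_minus_1) (simp only: mult_ac)
  also have "\<dots> = fps_const c * fps_X * fps_exp (c * (x + h))"
    by (simp only: distrib_left fps_exp_add_mult)
  finally show ?thesis
    by (rule bernpoly_fps_eqI[OF False])
qed (simp add: bernpoly_fps_0)

lemma bernpoly_fps_1: "bernpoly_fps c 1 = bernpoly_fps c 0 + fps_const c * fps_X"
proof (cases "c = 0")
  case False
  have "(bernpoly_fps c 0 + fps_const c * fps_X) * (fps_exp c - 1)
      = fps_const c * fps_X * fps_exp (c * 1)"
    by (simp only: distrib_right bernpoly_fps_mult_exp_minus_1) (simp add: algebra_simps)
  then show ?thesis
    by (rule bernpoly_fps_eqI[OF False])
qed (simp add: bernpoly_fps_0)

lemma bernpoly_fps_reflect: "bernpoly_fps (- c) (1 - x) = bernpoly_fps c x"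
proof (cases "c = 0")
  case False
  have inverse: "fps_exp c * fps_exp (- c) = (1 :: real fps)"
    by (simp flip: fps_exp_add_mult)
  have "bernpoly_fps (- c) (1 - x) * (fps_exp c - 1)
      = - fps_exp c * (bernpoly_fps (- c) (1 - x) * (fps_exp (- c) - 1))"
    using inverse by algebra
  also have "\<dots> = fps_const c * fps_X * (fps_exp c * fps_exp (- c * (1 - x)))"
    unfolding bernpoly_fps_mult_exp_minus_1 fps_const_neg[symmetric] by algebra
  also have "fps_exp c * fps_exp (- c * (1 - x)) = fps_exp (c * x)"
    by (simp add: algebra_simps flip: fps_exp_add_mult)
  finally show ?thesis
    by (rule bernpoly_fps_eqI[OF False, symmetric])
qed (simp add: bernpoly_fps_0)

lemma bernpoly_1: "bernpoly 1 x = x - 1 / 2"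
proof -
  have shift: "bernpoly 1 t = bernpoly 1 0 + t" for t
    using arg_cong[OF bernpoly_fps_add[of 1 0 t], of "\<lambda>f. fps_nth f 1"]
    by (simp add: fps_mult_nth_1 bernpoly_fps_def bernpoly_0)
  have "- bernpoly 1 1 = bernpoly 1 0"
    using arg_cong[OF bernpoly_fps_reflect[of 1 0], of "\<lambda>f. fps_nth f 1"]
    by (simp add: bernpoly_fps_def)
  with shift[of 1] shift[of x] show ?thesis
    by simp
qed

definition bernfun_fps :: "real \<Rightarrow> real \<Rightarrow> real fps" where
  "bernfun_fps c x = Abs_fps (\<lambda>n. bernfun n x / fact n * c ^ n)"

definition bernfun_half_jump :: "real \<Rightarrow> real \<Rightarrow> real fps" where
  "bernfun_half_jump c x = (if x \<in> \<int> then fps_const (c / 2) * fps_X else 0)"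

lemma bernfun_fps_eq_bernpoly_fps:
  "bernfun_fps c x = bernpoly_fps c (frac x) + bernfun_half_jump c x"
proof (rule fps_ext)
  fix n :: nat
  consider "n = 0" | "n = 1" | "n \<noteq> 0" "n \<noteq> 1" by blast
  then show "fps_nth (bernfun_fps c x) n
      = fps_nth (bernpoly_fps c (frac x) + bernfun_half_jump c x) n"
  proof cases
    case 2
    then show ?thesis
      using bernpoly_1[of "frac x"] frac_eq_0_iff[of x]
      by (auto simp: bernfun_fps_def bernpoly_fps_def bernfun_def bernfun_half_jump_def
          simp del: frac_eq_0_iff)
  qed (simp_all add: bernfun_fps_def bernpoly_fps_def bernfun_def bernfun_half_jump_def bernpoly_0)
qed

lemma bernfun_half_jump_double:
  "x \<in> \<int> \<Longrightarrow> bernfun_half_jump c x + bernfun_half_jump c x = fps_const c * fps_X"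
  by (simp add: bernfun_half_jump_def flip: distrib_right)

lemma bernfun_fps_reflect: "bernfun_fps (- c) (- x) = bernfun_fps c x"
proof (cases "x \<in> \<int>")
  case True
  have "bernpoly_fps (- c) 0 = bernpoly_fps (- c) 1 + fps_const c * fps_X"
    by (simp add: bernpoly_fps_1 flip: fps_const_neg)
  also have "bernpoly_fps (- c) 1 = bernpoly_fps c 0"
    using bernpoly_fps_reflect[of c 0] by simp
  also have "fps_const c * fps_X = bernfun_half_jump c x + bernfun_half_jump c x"
    using True by (simp only: bernfun_half_jump_double)
  finally have "bernpoly_fps (- c) 0
      = bernpoly_fps c 0 + (bernfun_half_jump c x + bernfun_half_jump c x)" .
  moreover have "bernfun_half_jump (- c) (- x) = - bernfun_half_jump c x"
    using True by (simp add: bernfun_half_jump_def flip: fps_const_neg)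
  moreover have "frac x = 0" "frac (- x) = 0"
    using True by simp_all
  ultimately show ?thesis
    by (simp only: bernfun_fps_eq_bernpoly_fps) simp
next
  case False
  then show ?thesis
    by (simp add: bernfun_fps_eq_bernpoly_fps bernfun_half_jump_def frac_neg bernpoly_fps_reflect)
qed

lemma bernfun_fps_add_of_int: "bernfun_fps c (x + of_int k) = bernfun_fps c x"
  by (simp add: bernfun_fps_eq_bernpoly_fps bernfun_half_jump_def frac_def)

subsection \<open>Exponential functions with jumps\<close>

text \<open>
  The value of \<open>f\<close> at a jump is the mean of its one-sided limits, and \<open>J\<close> is half of the drop.
\<close>
definition exp_with_jumps :: "real \<Rightarrow> (real \<Rightarrow> real fps) \<Rightarrow> (real \<Rightarrow> real fps) \<Rightarrow> bool" where
  "exp_with_jumps c f J \<longleftrightarrow>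
     (\<forall>x. \<forall>\<^sub>F h in at 0.
        f (x + h) = fps_exp (c * h) * (f x - fps_const (sgn h) * J x) \<and> J (x + h) = 0)"

lemma exp_with_jumps_zero: "exp_with_jumps c (\<lambda>x. 0) (\<lambda>x. 0)"
  by (simp add: exp_with_jumps_def)

lemma exp_with_jumps_add:
  assumes "exp_with_jumps c f J" and "exp_with_jumps c g K"
  shows "exp_with_jumps c (\<lambda>x. f x + g x) (\<lambda>x. J x + K x)"
  unfolding exp_with_jumps_def
proof
  fix x
  show "\<forall>\<^sub>F h in at 0. f (x + h) + g (x + h)
      = fps_exp (c * h) * (f x + g x - fps_const (sgn h) * (J x + K x)) \<and> J (x + h) + K (x + h) = 0"
    using assms[unfolded exp_with_jumps_def, rule_format, of x]
    by eventually_elim (elim conjE, intro conjI; algebra)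
qed

lemma exp_with_jumps_cmult:
  assumes "exp_with_jumps c f J"
  shows "exp_with_jumps c (\<lambda>x. F * f x) (\<lambda>x. F * J x)"
  unfolding exp_with_jumps_def
proof
  fix x
  show "\<forall>\<^sub>F h in at 0. F * f (x + h)
      = fps_exp (c * h) * (F * f x - fps_const (sgn h) * (F * J x)) \<and> F * J (x + h) = 0"
    using assms[unfolded exp_with_jumps_def, rule_format, of x]
    by eventually_elim (elim conjE, intro conjI; algebra)
qed

lemma exp_with_jumps_sum:
  assumes "\<And>l. l \<in> A \<Longrightarrow> exp_with_jumps c (f l) (J l)"
  shows "exp_with_jumps c (\<lambda>x. \<Sum>l\<in>A. f l x) (\<lambda>x. \<Sum>l\<in>A. J l x)"
  using assms
  by (induction A rule: infinite_finite_induct)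
    (simp_all add: exp_with_jumps_zero exp_with_jumps_add)

lemma exp_with_jumps_affine:
  assumes "exp_with_jumps c f J" and "a \<noteq> 0"
  shows "exp_with_jumps (a * c) (\<lambda>x. f (a * x + y)) (\<lambda>x. fps_const (sgn a) * J (a * x + y))"
  unfolding exp_with_jumps_def
proof
  fix x
  from assms have "\<forall>\<^sub>F k in at 0. f (a * x + y + k)
      = fps_exp (c * k) * (f (a * x + y) - fps_const (sgn k) * J (a * x + y))
      \<and> J (a * x + y + k) = 0"
    by (simp add: exp_with_jumps_def)
  moreover have "filterlim (\<lambda>h. a * h) (at 0) (at 0)"
    using assms by (auto simp: filterlim_at eventually_at_filter intro!: tendsto_eq_intros)
  ultimately have "\<forall>\<^sub>F h in at 0. f (a * x + y + a * h)
      = fps_exp (c * (a * h)) * (f (a * x + y) - fps_const (sgn (a * h)) * J (a * x + y))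
      \<and> J (a * x + y + a * h) = 0"
    by (rule eventually_compose_filterlim)
  then show "\<forall>\<^sub>F h in at 0. f (a * (x + h) + y)
      = fps_exp (a * c * h) *
        (f (a * x + y) - fps_const (sgn h) * (fps_const (sgn a) * J (a * x + y)))
      \<and> fps_const (sgn a) * J (a * (x + h) + y) = 0"
    by eventually_elim (simp add: algebra_simps sgn_mult flip: fps_const_mult)
qed

text \<open>
  The summand \<open>J x * K x\<close> absorbs the square of the sign in the product of the two jumps.
\<close>
lemma exp_with_jumps_mult:
  assumes "exp_with_jumps c f J" and "exp_with_jumps d g K"
  shows "exp_with_jumps (c + d) (\<lambda>x. f x * g x + J x * K x) (\<lambda>x. J x * g x + f x * K x)"
  unfolding exp_with_jumps_def
proof
  fix x
  have "\<forall>\<^sub>F h in at 0. h \<noteq> (0 :: real)"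
    by (simp add: eventually_at_filter)
  with assms[unfolded exp_with_jumps_def, rule_format, of x]
  show "\<forall>\<^sub>F h in at 0. f (x + h) * g (x + h) + J (x + h) * K (x + h)
      = fps_exp ((c + d) * h) * (f x * g x + J x * K x - fps_const (sgn h) * (J x * g x + f x * K x))
      \<and> J (x + h) * g (x + h) + f (x + h) * K (x + h) = 0"
  proof eventually_elim
    case (elim h)
    have exp_add: "fps_exp ((c + d) * h) = fps_exp (c * h) * (fps_exp (d * h) :: real fps)"
      by (simp add: distrib_right fps_exp_add_mult)
    have "fps_const (sgn h) * fps_const (sgn h) = 1"
      using elim by (simp add: sgn_if)
    with exp_add elim(1,2) show ?case
      by (elim conjE, intro conjI; algebra)
  qed
qed

lemma periodic_locally_exp_imp_zero:
  fixes f :: "real \<Rightarrow> real fps"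
  assumes "c \<noteq> 0"
    and local: "\<And>x. \<forall>\<^sub>F h in at 0. f (x + h) = fps_exp (c * h) * f x"
    and periodic: "\<And>x. f (x + 1) = f x"
  shows "f x = 0"
proof -
  define g where "g t = fps_exp (- c * t) * f t" for t
  have "g x = g (x + 1)"
  proof (rule connected_local_const[OF connected_UNIV])
    show "\<forall>t\<in>UNIV. \<forall>\<^sub>F t' in at t. g t = g t'"
    proof
      fix t
      from local[of t] have "\<forall>\<^sub>F h in at 0. g t = g (h + t)"
      proof eventually_elim
        case (elim h)
        have "fps_exp (- c * (h + t)) * fps_exp (c * h) = fps_exp (- c * t)"
          by (simp add: algebra_simps flip: fps_exp_add_mult)
        then show ?case
          using elim by (simp only: g_def add.commute[of h t] mult.assoc[symmetric])
      qed
      then show "\<forall>\<^sub>F t' in at t. g t = g t'"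
        by (simp add: eventually_at_to_0[of _ t])
    qed
  qed auto
  also have "\<dots> = fps_exp (- c) * g x"
    by (simp only: g_def periodic distrib_left fps_exp_add_mult) (simp add: mult_ac)
  finally have "g x = 0"
    using \<open>c \<noteq> 0\<close> by simp
  then show ?thesis
    by (simp add: g_def)
qed

lemma exp_with_jumps_unique:
  assumes "c \<noteq> 0" and "exp_with_jumps c f J" and "exp_with_jumps c g J"
    and "\<And>x. f (x + 1) = f x" and "\<And>x. g (x + 1) = g x"
  shows "f x = g x"
proof -
  have "f x - g x = 0"
  proof (rule periodic_locally_exp_imp_zero[OF \<open>c \<noteq> 0\<close>])
    fix x
    show "\<forall>\<^sub>F h in at 0. f (x + h) - g (x + h) = fps_exp (c * h) * (f x - g x)"
      using assms(2,3)[unfolded exp_with_jumps_def, rule_format, of x]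
      by eventually_elim (elim conjE, algebra)
  qed (simp add: assms)
  then show ?thesis
    by simp
qed

subsection \<open>Jumps of the Bernoulli functions\<close>

lemma eventually_frac_add:
  fixes x :: real
  shows "\<forall>\<^sub>F h in at 0.
    frac (x + h) = (if x \<in> \<int> \<and> h < 0 then 1 else frac x) + h \<and> x + h \<notin> \<int>"
proof (cases "x \<in> \<int>")
  case True
  have "\<forall>\<^sub>F h in at 0. h \<in> {-1<..<1} - {0 :: real}"
    by (rule eventually_at_in_open) auto
  then show ?thesis
  proof eventually_elim
    case (elim h)
    define r where "r = (if h < 0 then 1 else 0) + h"
    have "x + h - r \<in> \<int>" "0 < r" "r < 1"
      using True elim by (auto simp: r_def)
    then have "frac (x + h) = r"
      by (simp add: frac_unique_iff)
    with \<open>0 < r\<close> True show ?case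
      by (auto simp: r_def simp flip: frac_eq_0_iff)
  qed
next
  case False
  then have "0 < frac x" "frac x < 1"
    by (simp_all add: frac_lt_1)
  then have "\<forall>\<^sub>F h in at 0. h \<in> {- frac x<..<1 - frac x}"
    by (intro eventually_at_in_open') auto
  then show ?thesis
  proof eventually_elim
    case (elim h)
    have "x + h - (frac x + h) \<in> \<int>"
      by (simp add: frac_def)
    with elim have "frac (x + h) = frac x + h"
      by (simp add: frac_unique_iff)
    with elim False show ?case
      by (auto simp flip: frac_eq_0_iff)
  qed
qed

lemma exp_with_jumps_bernfun_fps: "exp_with_jumps c (bernfun_fps c) (bernfun_half_jump c)"
  unfolding exp_with_jumps_def
proof
  fix x
  have one_sided_limit: "bernpoly_fps c (if x \<in> \<int> \<and> h < 0 then 1 else frac x)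
      = bernfun_fps c x - fps_const (sgn h) * bernfun_half_jump c x" if "h \<noteq> 0" for h :: real
  proof (cases "x \<in> \<int>")
    case True
    then have "frac x = 0"
      by simp
    then show ?thesis
      using bernfun_half_jump_double[OF True, of c] True that
      by (simp add: bernfun_fps_eq_bernpoly_fps bernpoly_fps_1 sgn_if
          del: frac_eq_0_iff flip: fps_const_neg)
  next
    case False
    then show ?thesis
      by (simp add: bernfun_fps_eq_bernpoly_fps bernfun_half_jump_def)
  qed
  have "\<forall>\<^sub>F h in at 0. h \<noteq> (0 :: real)"
    by (simp add: eventually_at_filter)
  with eventually_frac_add[of x]
  show "\<forall>\<^sub>F h in at 0. bernfun_fps c (x + h)
      = fps_exp (c * h) * (bernfun_fps c x - fps_const (sgn h) * bernfun_half_jump c x)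
      \<and> bernfun_half_jump c (x + h) = 0"
  proof eventually_elim
    case (elim h)
    then have no_jump: "bernfun_half_jump c (x + h) = 0"
      by (simp add: bernfun_half_jump_def)
    then have "bernfun_fps c (x + h)
        = bernpoly_fps c ((if x \<in> \<int> \<and> h < 0 then 1 else frac x) + h)"
      using elim by (simp only: bernfun_fps_eq_bernpoly_fps) simp
    also have "\<dots> = fps_exp (c * h) * (bernfun_fps c x - fps_const (sgn h) * bernfun_half_jump c x)"
      by (simp only: bernpoly_fps_add one_sided_limit[OF \<open>h \<noteq> 0\<close>])
    finally show ?case
      using no_jump by blast
  qed
qed

lemma ex1_dvd_add_int:
  fixes b N :: int
  assumes "b \<noteq> 0"
  shows "\<exists>!l. l \<in> {1..\<bar>b\<bar>} \<and> b dvd N + l"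
proof (rule ex1I)
  define l where "l = \<bar>b\<bar> - N mod \<bar>b\<bar>"
  have "l \<in> {1..\<bar>b\<bar>}"
    using assms pos_mod_bound[of "\<bar>b\<bar>" N] pos_mod_sign[of "\<bar>b\<bar>" N]
    unfolding l_def atLeastAtMost_iff by linarith
  moreover have "N + l = (N - N mod \<bar>b\<bar>) + \<bar>b\<bar>"
    by (simp add: l_def)
  then have "b dvd N + l"
    by (metis abs_dvd_iff dvd_add dvd_minus_mod dvd_refl)
  ultimately show l: "l \<in> {1..\<bar>b\<bar>} \<and> b dvd N + l"
    by simp
  fix k
  assume k: "k \<in> {1..\<bar>b\<bar>} \<and> b dvd N + k"
  have "b dvd k - l"
    using dvd_diff[of b "N + k" "N + l"] k l by simp
  moreover have "\<bar>k - l\<bar> < \<bar>b\<bar>"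
    using k l by auto
  ultimately show "k = l"
    using dvd_imp_le_int[of "k - l" b] by linarith
qed

lemma add_divide_in_Ints_iff:
  fixes b l :: int and x z :: real
  assumes "b \<noteq> 0"
  shows "x + (of_int l + z) / of_int b \<in> \<int> \<longleftrightarrow> (\<exists>k. of_int b * x + z = of_int (b * k - l))"
  using assms by (auto simp: Ints_def field_simps)

lemma ex1_add_divide_in_Ints:
  fixes b :: int and x z :: real
  assumes "b \<noteq> 0" and "of_int b * x + z \<in> \<int>"
  shows "\<exists>!l. l \<in> {1..\<bar>b\<bar>} \<and> x + (of_int l + z) / of_int b \<in> \<int>"
proof -
  from assms obtain N where N: "of_int b * x + z = of_int N"
    by (elim Ints_cases)
  have "x + (of_int l + z) / of_int b \<in> \<int> \<longleftrightarrow> b dvd N + l" for l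
    unfolding add_divide_in_Ints_iff[OF \<open>b \<noteq> 0\<close>] N of_int_eq_iff dvd_def
    by (auto simp: algebra_simps)
  then show ?thesis
    using ex1_dvd_add_int[OF \<open>b \<noteq> 0\<close>, of N] by presburger
qed

lemma sum_if_Ints_periodic:
  fixes f :: "real \<Rightarrow> 'a :: comm_monoid_add" and b :: int and x z :: real
  assumes "b \<noteq> 0" and periodic: "\<And>t k. f (t + of_int k) = f t"
  shows "(\<Sum>l = 1..\<bar>b\<bar>. if x + (of_int l + z) / of_int b \<in> \<int> then f ((of_int l + z) / of_int b) else 0)
    = (if of_int b * x + z \<in> \<int> then f (- x) else 0)"
proof (cases "of_int b * x + z \<in> \<int>")
  case True
  define r where "r l = (of_int l + z) / of_int b" for l
  obtain l0 where "l0 \<in> {1..\<bar>b\<bar>}"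
    and Ints_iff: "\<And>l. l \<in> {1..\<bar>b\<bar>} \<Longrightarrow> x + r l \<in> \<int> \<longleftrightarrow> l = l0"
    using ex1_add_divide_in_Ints[OF \<open>b \<noteq> 0\<close> True] unfolding r_def by blast
  have "f (r l0) = f (- x)"
  proof -
    from Ints_iff[OF \<open>l0 \<in> {1..\<bar>b\<bar>}\<close>] obtain k where "x + r l0 = of_int k"
      by (auto elim: Ints_cases)
    then have "r l0 = - x + of_int k"
      by linarith
    then show ?thesis
      by (simp only: periodic)
  qed
  have "(\<Sum>l = 1..\<bar>b\<bar>. if x + r l \<in> \<int> then f (r l) else 0)
      = (\<Sum>l = 1..\<bar>b\<bar>. if l = l0 then f (r l) else 0)"
    by (intro sum.cong refl) (simp only: Ints_iff)
  also have "\<dots> = f (- x)"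
    using \<open>l0 \<in> {1..\<bar>b\<bar>}\<close> \<open>f (r l0) = f (- x)\<close> by simp
  finally show ?thesis
    using True by (simp only: r_def if_True)
next
  case False
  then have "x + (of_int l + z) / of_int b \<notin> \<int>" for l
    unfolding add_divide_in_Ints_iff[OF \<open>b \<noteq> 0\<close>] using Ints_of_int by metis
  with False show ?thesis
    by simp
qed

lemma exp_with_jumps_bernfun_fps_affine:
  fixes a :: int
  assumes "a \<noteq> 0"
  shows "exp_with_jumps (of_int a * c) (\<lambda>x. bernfun_fps c (of_int a * x + y))
    (\<lambda>x. fps_const (of_int (sgn a)) * bernfun_half_jump c (of_int a * x + y))"
proof -
  have "sgn (real_of_int a) = of_int (sgn a)"
    by (simp add: sgn_if)
  then show ?thesis
    using exp_with_jumps_affine[OF exp_with_jumps_bernfun_fps, of "of_int a"] assms by simp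
qed

definition corrected_bernfun_fps :: "real \<Rightarrow> real \<Rightarrow> real \<Rightarrow> real \<Rightarrow> real \<Rightarrow> real fps" where
  "corrected_bernfun_fps s u v p q =
     bernfun_fps u p * bernfun_fps v q
     + fps_const s * (bernfun_half_jump u p * bernfun_half_jump v q)"

lemma corrected_bernfun_fps_add_of_int:
  "corrected_bernfun_fps s u v (p + of_int k) (q + of_int l) = corrected_bernfun_fps s u v p q"
  by (simp add: corrected_bernfun_fps_def bernfun_fps_add_of_int bernfun_half_jump_def)

lemma exp_with_jumps_corrected_bernfun_fps:
  fixes a b :: int
  assumes "a \<noteq> 0" and "b \<noteq> 0"
  shows "exp_with_jumps (of_int a * u + of_int b * v)
    (\<lambda>x. corrected_bernfun_fps (of_int (sgn (a * b))) u v (of_int a * x + y) (of_int b * x + z))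
    (\<lambda>x. fps_const (of_int (sgn a)) * bernfun_half_jump u (of_int a * x + y) *
        bernfun_fps v (of_int b * x + z)
      + bernfun_fps u (of_int a * x + y) *
        (fps_const (of_int (sgn b)) * bernfun_half_jump v (of_int b * x + z)))"
proof -
  have "corrected_bernfun_fps (of_int (sgn (a * b))) u v p q = bernfun_fps u p * bernfun_fps v q
      + (fps_const (of_int (sgn a)) * bernfun_half_jump u p) *
        (fps_const (of_int (sgn b)) * bernfun_half_jump v q)"
    for p q
    by (simp add: corrected_bernfun_fps_def sgn_mult mult_ac flip: fps_const_mult)
  with exp_with_jumps_mult[OF exp_with_jumps_bernfun_fps_affine
      exp_with_jumps_bernfun_fps_affine, OF assms]
  show ?thesis
    by (simp only:)
qed

definition dedekind_bernfun_fps :: "int \<Rightarrow> int \<Rightarrow> real \<Rightarrow> real \<Rightarrow> real \<Rightarrow> real \<Rightarrow> real \<Rightarrow> real fps" where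
  "dedekind_bernfun_fps a b y z u w x =
     (\<Sum>l = 1..\<bar>b\<bar>. bernfun_fps (- u) (of_int a * (of_int l + z) / of_int b - y) *
        bernfun_fps w (x + (of_int l + z) / of_int b))"

lemma dedekind_bernfun_fps_add_1:
  "dedekind_bernfun_fps a b y z u w (x + 1) = dedekind_bernfun_fps a b y z u w x"
proof -
  have "bernfun_fps w (x + 1 + r) = bernfun_fps w (x + r)" for r
    using bernfun_fps_add_of_int[of w "x + r" 1] by (simp add: algebra_simps)
  then show ?thesis
    by (simp only: dedekind_bernfun_fps_def)
qed

lemma exp_with_jumps_dedekind_bernfun_fps:
  assumes "b \<noteq> 0"
  shows "exp_with_jumps w (dedekind_bernfun_fps a b y z u w)
    (\<lambda>x. bernfun_half_jump w (of_int b * x + z) * bernfun_fps u (of_int a * x + y))"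
proof -
  define r where "r l = (of_int l + z) / of_int b" for l
  define f where "f t = bernfun_fps (- u) (of_int a * t - y)" for t
  have f_periodic: "f (t + of_int k) = f t" for t k
    using bernfun_fps_add_of_int[of "- u" "of_int a * t - y" "a * k"]
    by (simp add: f_def algebra_simps)
  have f_minus: "f (- t) = bernfun_fps u (of_int a * t + y)" for t
    using bernfun_fps_reflect[of u "of_int a * t + y"] by (simp add: f_def)
  have "exp_with_jumps w (\<lambda>x. bernfun_fps w (x + t)) (\<lambda>x. bernfun_half_jump w (x + t))" for t
    using exp_with_jumps_affine[OF exp_with_jumps_bernfun_fps[of w], of 1 t] by simp
  then have "exp_with_jumps w
      (\<lambda>x. \<Sum>l = 1..\<bar>b\<bar>. f (r l) * bernfun_fps w (x + r l))
      (\<lambda>x. \<Sum>l = 1..\<bar>b\<bar>. f (r l) * bernfun_half_jump w (x + r l))"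
    by (intro exp_with_jumps_sum exp_with_jumps_cmult)
  moreover have "(\<Sum>l = 1..\<bar>b\<bar>. f (r l) * bernfun_half_jump w (x + r l))
      = bernfun_half_jump w (of_int b * x + z) * bernfun_fps u (of_int a * x + y)" for x
    using sum_if_Ints_periodic[OF \<open>b \<noteq> 0\<close>, of "\<lambda>t. f t * (fps_const (w / 2) * fps_X)" x z]
    by (simp add: bernfun_half_jump_def r_def f_periodic f_minus if_distrib mult_ac cong: if_cong)
  ultimately show ?thesis
    by (simp add: dedekind_bernfun_fps_def[abs_def] f_def r_def)
qed

lemma fps_const_mult_bernfun_half_jump_commute:
  "fps_const d * bernfun_half_jump c x = fps_const c * bernfun_half_jump d x"
  by (simp add: bernfun_half_jump_def mult_ac)

lemma corrected_bernfun_fps_formula: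
  fixes a b :: int and u v w x y z :: real
  assumes "a \<noteq> 0" and "b \<noteq> 0" and w: "w = of_int a * u + of_int b * v" and "w \<noteq> 0"
  shows "fps_const w *
      corrected_bernfun_fps (of_int (sgn (a * b))) u v (of_int a * x + y) (of_int b * x + z)
    = fps_const (v * of_int (sgn b)) * dedekind_bernfun_fps a b y z u w x
      + fps_const (u * of_int (sgn a)) * dedekind_bernfun_fps b a z y v w x"
    (is "?lhs x = ?rhs x")
proof (rule exp_with_jumps_unique[OF \<open>w \<noteq> 0\<close>])
  let ?p = "\<lambda>x. of_int a * x + y" and ?q = "\<lambda>x. of_int b * x + z"
  let ?jump = "\<lambda>x.
    fps_const (v * of_int (sgn b)) * (bernfun_half_jump w (?q x) * bernfun_fps u (?p x))
    + fps_const (u * of_int (sgn a)) * (bernfun_half_jump w (?p x) * bernfun_fps v (?q x))"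
  have "?jump t = fps_const w *
      (fps_const (of_int (sgn a)) * bernfun_half_jump u (?p t) * bernfun_fps v (?q t)
        + bernfun_fps u (?p t) * (fps_const (of_int (sgn b)) * bernfun_half_jump v (?q t)))" for t
    using fps_const_mult_bernfun_half_jump_commute[of w u "?p t"]
      fps_const_mult_bernfun_half_jump_commute[of w v "?q t"]
    unfolding fps_const_mult[symmetric] by algebra
  with exp_with_jumps_cmult[OF exp_with_jumps_corrected_bernfun_fps[OF assms(1,2), of u v y z],
      of "fps_const w"]
  show "exp_with_jumps w ?lhs ?jump"
    by (simp only: w)
  show "exp_with_jumps w ?rhs ?jump"
    using assms
    by (intro exp_with_jumps_add exp_with_jumps_cmult exp_with_jumps_dedekind_bernfun_fps)
  show "?lhs (t + 1) = ?lhs t" for t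
  proof -
    have "of_int k * (t + 1) + r = of_int k * t + r + of_int k" for k r
      by (simp add: algebra_simps)
    then show ?thesis
      by (simp only: corrected_bernfun_fps_add_of_int)
  qed
  show "?rhs (t + 1) = ?rhs t" for t
    by (simp only: dedekind_bernfun_fps_add_1)
qed

subsection \<open>Coefficients of binary forms\<close>

definition binary_form :: "nat \<Rightarrow> (nat \<Rightarrow> 'a :: field_char_0) \<Rightarrow> 'a \<Rightarrow> 'a \<Rightarrow> 'a" where
  "binary_form N c u v = (\<Sum>i\<le>N. c i / (fact i * fact (N - i)) * (u ^ i * v ^ (N - i)))"

lemma binary_form_cmult: "binary_form N (\<lambda>i. r * c i) u v = r * binary_form N c u v"
  by (simp add: binary_form_def sum_distrib_left mult_ac)

lemma binary_form_sum:
  "binary_form N (\<lambda>i. \<Sum>l\<in>A. c l i) u v = (\<Sum>l\<in>A. binary_form N (c l) u v)"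
  unfolding binary_form_def by (subst sum.swap) (simp add: sum_divide_distrib sum_distrib_right)

lemma binary_form_swap: "binary_form N c u v = binary_form N (\<lambda>i. c (N - i)) v u"
  unfolding binary_form_def atMost_atLeast0
  by (subst sum.atLeastAtMost_rev) (simp add: mult_ac)

lemma binary_form_triangular_subst:
  "binary_form N H (c * u) (a * u + b * v)
    = binary_form N (\<lambda>i. b ^ (N - i) * (\<Sum>j\<le>i. of_nat (i choose j) * c ^ j * a ^ (i - j) * H j)) u v"
proof -
  define g where "g j k = H j * (c * u) ^ j * (a * u) ^ k * (b * v) ^ (N - (j + k))
    / (fact j * fact k * fact (N - (j + k)))" for j k
  have "H j / (fact j * fact (N - j)) * ((c * u) ^ j * (a * u + b * v) ^ (N - j))
      = (\<Sum>k\<le>N - j. g j k)" for j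
    unfolding binomial_ring sum_distrib_left
    by (intro sum.cong) (auto simp: g_def binomial_fact mult_ac)
  then have "binary_form N H (c * u) (a * u + b * v) = (\<Sum>(j, k)\<in>(SIGMA j:{..N}. {..N - j}). g j k)"
    by (simp add: binary_form_def sum.Sigma)
  also have "(SIGMA j:{..N}. {..N - j}) = {(j, k). j + k \<le> N}"
    by auto
  also have "(\<Sum>(j, k)\<in>{(j, k). j + k \<le> N}. g j k) = (\<Sum>i\<le>N. \<Sum>j\<le>i. g j (i - j))"
    by (rule sum.triangle_reindex_eq)
  also have "\<dots>
      = binary_form N (\<lambda>i. b ^ (N - i) * (\<Sum>j\<le>i. of_nat (i choose j) * c ^ j * a ^ (i - j) * H j)) u v"
    unfolding binary_form_def
  proof (rule sum.cong)
    fix i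
    have "g j (i - j) = b ^ (N - i) / (fact i * fact (N - i)) * (u ^ i * v ^ (N - i)) *
        (of_nat (i choose j) * c ^ j * a ^ (i - j) * H j)" if "j \<le> i" for j
    proof -
      have "u ^ i = u ^ j * u ^ (i - j)"
        using that by (simp flip: power_add)
      with that show ?thesis
        by (simp add: g_def binomial_fact power_mult_distrib mult_ac)
    qed
    then show "(\<Sum>j\<le>i. g j (i - j))
        = b ^ (N - i) * (\<Sum>j\<le>i. of_nat (i choose j) * c ^ j * a ^ (i - j) * H j)
          / (fact i * fact (N - i)) * (u ^ i * v ^ (N - i))"
      by (simp add: sum_distrib_left sum_divide_distrib sum_distrib_right mult_ac)
  qed simp
  finally show ?thesis .
qed

lemma poly_eq_0_if_vanishes_off_roots:
  fixes p q :: "'a :: {idom, ring_char_0} poly"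
  assumes "q \<noteq> 0" and "\<And>s. poly q s \<noteq> 0 \<Longrightarrow> poly p s = 0"
  shows "p = 0"
proof -
  have "poly (p * q) = poly 0"
    using assms(2) by (auto simp: fun_eq_iff)
  then show ?thesis
    using assms(1) by (simp only: poly_eq_poly_eq_iff) simp
qed

lemma binary_form_linear_mult_coeffs:
  fixes a b :: "'a :: field_char_0"
  assumes "a \<noteq> 0 \<or> b \<noteq> 0" and "m \<ge> 1" and "n \<ge> 1"
    and forms_eq: "\<And>u v. a * u + b * v \<noteq> 0 \<Longrightarrow> (a * u + b * v) * binary_form (m + n - 1) f u v
      = v * binary_form (m + n - 1) g u v + u * binary_form (m + n - 1) h u v"
  shows "of_nat m * a * f (m - 1) + of_nat n * b * f m = of_nat n * g m + of_nat m * h (m - 1)"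
proof -
  define N where "N = m + n - 1"
  define P where "P c = (\<Sum>i\<le>N. monom (c i / (fact i * fact (N - i))) i)" for c :: "nat \<Rightarrow> 'a"
  have poly_P: "poly (P c) s = binary_form N c s 1" for c s
    by (simp add: P_def binary_form_def poly_sum poly_monom)
  have coeff_P: "coeff (P c) i = c i / (fact i * fact (N - i))" if "i \<le> N" for c i
    using that by (simp add: P_def coeff_sum)
  have "[:b, a:] * P f - (P g + pCons 0 (P h)) = 0"
  proof (rule poly_eq_0_if_vanishes_off_roots)
    show "[:b, a:] \<noteq> 0"
      using assms(1) by auto
    show "poly ([:b, a:] * P f - (P g + pCons 0 (P h))) s = 0" if "poly [:b, a:] s \<noteq> 0" for s
      using forms_eq[of s 1] that by (simp add: poly_P N_def algebra_simps)
  qed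
  then have "coeff ([:b, a:] * P f) m = coeff (P g + pCons 0 (P h)) m"
    by simp
  moreover have "coeff (pCons r p) m = coeff p (m - 1)" for r and p :: "'a poly"
    using \<open>m \<ge> 1\<close> by (cases m) simp_all
  moreover have "m \<le> N" "N - (m - 1) = n" "N - m = n - 1"
    using assms(2,3) by (simp_all add: N_def)
  ultimately have "a * (f (m - 1) / (fact (m - 1) * fact n)) + b * (f m / (fact m * fact (n - 1)))
      = g m / (fact m * fact (n - 1)) + h (m - 1) / (fact (m - 1) * fact n)"
    by (simp add: coeff_P add.commute)
  moreover have "fact m = of_nat m * (fact (m - 1) :: 'a)"
    "fact n = of_nat n * (fact (n - 1) :: 'a)"
    using assms(2,3) by (simp_all add: fact_reduce)
  ultimately show ?thesis
    using assms(2,3) by (simp add: field_simps)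
qed

subsection \<open>The product formula\<close>

definition corrected_bernfun_prod :: "real \<Rightarrow> real \<Rightarrow> real \<Rightarrow> nat \<Rightarrow> nat \<Rightarrow> real" where
  "corrected_bernfun_prod s p q i j =
     bernfun i p * bernfun j q + s * delta_Ints p * delta_Ints q * kronecker 1 i * kronecker 1 j / 4"

lemma fps_nth_bernfun_fps_mult:
  "fps_nth (bernfun_fps u p * bernfun_fps v q) N
    = binary_form N (\<lambda>i. bernfun i p * bernfun (N - i) q) u v"
  by (simp add: fps_mult_nth bernfun_fps_def binary_form_def atMost_atLeast0 mult_ac)

lemma fps_nth_corrected_bernfun_fps:
  "fps_nth (corrected_bernfun_fps s u v p q) N
    = binary_form N (\<lambda>i. corrected_bernfun_prod s p q i (N - i)) u v"
proof -
  have "fps_nth (bernfun_half_jump c t) k = kronecker 1 k * delta_Ints t / 2 / fact k * c ^ k"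
    for c t k
    by (cases "k = 1") (simp_all add: bernfun_half_jump_def kronecker_def delta_Ints_def)
  then have "fps_nth (bernfun_half_jump u p * bernfun_half_jump v q) N
      = binary_form N (\<lambda>i. delta_Ints p * delta_Ints q * kronecker 1 i * kronecker 1 (N - i) / 4) u v"
    by (simp add: fps_mult_nth binary_form_def atMost_atLeast0 mult_ac)
  then show ?thesis
    unfolding corrected_bernfun_fps_def fps_add_nth fps_mult_left_const_nth fps_nth_bernfun_fps_mult
    by (simp add: binary_form_def corrected_bernfun_prod_def sum_distrib_left add_divide_distrib
        distrib_left distrib_right mult_ac flip: sum.distrib)
qed

definition dedekind_bernfun_sum :: "int \<Rightarrow> int \<Rightarrow> real \<Rightarrow> real \<Rightarrow> real \<Rightarrow> nat \<Rightarrow> nat \<Rightarrow> real" where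
  "dedekind_bernfun_sum a b y z x j k =
     (\<Sum>l = 1..\<bar>b\<bar>. bernfun j (of_int a * (of_int l + z) / of_int b - y) *
        bernfun k (x + (of_int l + z) / of_int b))"

definition binomial_dedekind_sum :: "int \<Rightarrow> int \<Rightarrow> real \<Rightarrow> real \<Rightarrow> real \<Rightarrow> nat \<Rightarrow> nat \<Rightarrow> real" where
  "binomial_dedekind_sum a b y z x N m =
     (\<Sum>j\<le>m. real (m choose j) * (- 1) ^ j * of_int a ^ (m - j) *
        dedekind_bernfun_sum a b y z x j (N - j))"

lemma fps_nth_dedekind_bernfun_fps:
  "fps_nth (dedekind_bernfun_fps a b y z u (of_int a * u + of_int b * v) x) N
    = binary_form N (\<lambda>i. of_int b ^ (N - i) * binomial_dedekind_sum a b y z x N i) u v"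
proof -
  have "fps_nth (dedekind_bernfun_fps a b y z u w x) N
      = binary_form N (\<lambda>j. dedekind_bernfun_sum a b y z x j (N - j)) (- 1 * u) w" for w
    by (simp add: dedekind_bernfun_fps_def dedekind_bernfun_sum_def fps_sum_nth
        fps_nth_bernfun_fps_mult binary_form_sum)
  then show ?thesis
    by (simp only: binary_form_triangular_subst binomial_dedekind_sum_def)
qed

lemma binary_form_corrected_bernfun_prod:
  fixes a b :: int and u v x y z :: real
  assumes "a \<noteq> 0" and "b \<noteq> 0" and "of_int a * u + of_int b * v \<noteq> 0"
  defines "C \<equiv> corrected_bernfun_prod (of_int (sgn (a * b))) (of_int a * x + y) (of_int b * x + z)"
  shows "(of_int a * u + of_int b * v) * binary_form N (\<lambda>i. C i (N - i)) u v
    = v * binary_form N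
        (\<lambda>i. of_int (sgn b) * (of_int b ^ (N - i) * binomial_dedekind_sum a b y z x N i)) u v
      + u * binary_form N
        (\<lambda>i. of_int (sgn a) * (of_int a ^ (N - i) * binomial_dedekind_sum b a z y x N i)) v u"
proof -
  define w where "w = of_int a * u + of_int b * v"
  then have w_commute: "w = of_int b * v + of_int a * u"
    by simp
  have "w * binary_form N (\<lambda>i. C i (N - i)) u v
      = v * (of_int (sgn b) * fps_nth (dedekind_bernfun_fps a b y z u w x) N)
        + u * (of_int (sgn a) * fps_nth (dedekind_bernfun_fps b a z y v w x) N)"
    using corrected_bernfun_fps_formula[OF assms(1,2) w_def, of x y z, THEN arg_cong,
      of "\<lambda>F. fps_nth F N"] assms(3)
    unfolding fps_add_nth fps_mult_left_const_nth fps_nth_corrected_bernfun_fps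
    by (simp add: w_def C_def)
  also have "fps_nth (dedekind_bernfun_fps a b y z u w x) N
      = binary_form N (\<lambda>i. of_int b ^ (N - i) * binomial_dedekind_sum a b y z x N i) u v"
    unfolding w_def by (rule fps_nth_dedekind_bernfun_fps)
  also have "fps_nth (dedekind_bernfun_fps b a z y v w x) N
      = binary_form N (\<lambda>i. of_int a ^ (N - i) * binomial_dedekind_sum b a z y x N i) v u"
    unfolding w_commute by (rule fps_nth_dedekind_bernfun_fps)
  finally show ?thesis
    by (simp only: w_def binary_form_cmult)
qed

lemma corrected_bernfun_prod_formula:
  fixes m n :: nat and a b :: int and x y z :: real
  assumes "m \<ge> 1" and "n \<ge> 1" and "a \<noteq> 0" and "b \<noteq> 0"
  defines "C \<equiv> corrected_bernfun_prod (of_int (sgn (a * b))) (of_int a * x + y) (of_int b * x + z)"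
  shows "real m * of_int a * C (m - 1) n + real n * of_int b * C m (n - 1)
    = real n * of_int b ^ (n - 1) * of_int (sgn b) * binomial_dedekind_sum a b y z x (m + n - 1) m
      + real m * of_int a ^ (m - 1) * of_int (sgn a) * binomial_dedekind_sum b a z y x (m + n - 1) n"
proof -
  define N where "N = m + n - 1"
  define f where "f i = C i (N - i)" for i
  define g where
    "g i = of_int (sgn b) * (of_int b ^ (N - i) * binomial_dedekind_sum a b y z x N i)" for i
  define h where
    "h i = of_int (sgn a) * (of_int a ^ (N - i) * binomial_dedekind_sum b a z y x N i)" for i
  have "real m * of_int a * f (m - 1) + real n * of_int b * f m
      = real n * g m + real m * h (N - (m - 1))"
  proof (rule binary_form_linear_mult_coeffs)
    show "(of_int a * u + of_int b * v) * binary_form (m + n - 1) f u v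
        = v * binary_form (m + n - 1) g u v + u * binary_form (m + n - 1) (\<lambda>i. h (N - i)) u v"
      if "of_int a * u + of_int b * v \<noteq> 0" for u v
      using binary_form_corrected_bernfun_prod[OF assms(3,4) that, of N x y z]
        binary_form_swap[of N h v u]
      unfolding N_def[symmetric] by (simp add: f_def[abs_def] g_def[abs_def] h_def[abs_def] C_def)
  qed (use assms in simp_all)
  moreover have "N - (m - 1) = n" "N - m = n - 1" "N - n = m - 1"
    using assms(1,2) by (simp_all add: N_def)
  ultimately show ?thesis
    by (simp add: f_def g_def h_def N_def mult_ac)
qed

theorem theorem3p3:
  fixes m n :: nat and a b :: int and x y z :: real
  assumes "m \<ge> 1" and "n \<ge> 1" and "a \<noteq> 0" and "b \<noteq> 0"
  shows
    "real m * real_of_int a * bernfun (m - 1) (real_of_int a * x + y) * bernfun n (real_of_int b * x + z)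
     + real n * real_of_int b * bernfun m (real_of_int a * x + y) * bernfun (n - 1) (real_of_int b * x + z)
     = real n * real_of_int b ^ (n - 1) * real_of_int (sgn b) *
         (\<Sum>j = 0..m. real (m choose j) * (-1) ^ j * real_of_int a ^ (m - j) *
           (\<Sum>l = 1..\<bar>b\<bar>.
              bernfun j (real_of_int a * (real_of_int l + z) / real_of_int b - y) *
              bernfun (m + n - j - 1) (x + (real_of_int l + z) / real_of_int b)))
       + real m * real_of_int a ^ (m - 1) * real_of_int (sgn a) *
         (\<Sum>j = 0..n. real (n choose j) * (-1) ^ j * real_of_int b ^ (n - j) *
           (\<Sum>l = 1..\<bar>a\<bar>.
              bernfun j (real_of_int b * (real_of_int l + y) / real_of_int a - z) *
              bernfun (m + n - j - 1) (x + (real_of_int l + y) / real_of_int a)))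
       - real_of_int (sgn (a * b)) * delta_Ints (real_of_int a * x + y) * delta_Ints (real_of_int b * x + z) *
         ((kronecker 1 (m - 1) * kronecker 1 n * real m * real_of_int a
           + kronecker 1 m * kronecker 1 (n - 1) * real n * real_of_int b) / 4)"
    (is "?lhs = ?sum1 + ?sum2 - ?correction")
proof -
  let ?C = "corrected_bernfun_prod (of_int (sgn (a * b))) (of_int a * x + y) (of_int b * x + z)"
  have index: "m + n - j - 1 = m + n - 1 - j" for j
    by (rule diff_commute)
  have "?lhs + ?correction = real m * of_int a * ?C (m - 1) n + real n * of_int b * ?C m (n - 1)"
    by (simp add: corrected_bernfun_prod_def field_simps)
  also have "\<dots> = ?sum1 + ?sum2"
    unfolding corrected_bernfun_prod_formula[OF assms]
    unfolding binomial_dedekind_sum_def dedekind_bernfun_sum_def index atMost_atLeast0 ..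
  finally show ?thesis
    by (simp only: eq_diff_eq)
qed

end
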